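(* Let $h\ge 0$ be an integer and let $a=z_0,z_1,\dots,z_h$ be nonnegative real numbers with $a>0$. The stationary distribution of the add-drop model on $\mathrm{St}_h$ is given, for $B=b_1\cdots b_h\in\mathrm{St}_{h,k}$ (with $0\le k\le h$), by $$\Pi(B)=\frac{a^k}{Z_h}\prod_{\substack{i=1\\ b_i=\bullet}}^h\left(z_1+\cdots+z_{\psi_i(B)+1}\right),$$ where $\psi_i(B)=\#\{j: i<j\le h,\ b_j=\circ\}$ and $$Z_h=\sum_{k=0}^h a^k\,h_{h-k}(z_1,\ z_1+z_2,\ \dots,\ z_1+\cdots+z_{k+1}),$$ $h_\ell$ denoting the complete homogeneous symmetric polynomial of degree $\ell$ (the term $k=h$ is $a^h$, so that $z_{h+1}$ does not actually appear).
   Context: $\mathrm{St}_h$ is the set of words of length $h$ on $\{\bullet,\circ\}$ and $\mathrm{St}_{h,k}$ is the subset of words with exactly $k$ occurrences of $\circ$. For a word $A$ and an integer $i\ge 0$, $S_i(A)$ is the word obtained by replacing by $\bullet$ the $i$-th occurrence of $\circ$ in $A$ when $A$ is read from the right; if $i=0$ or $i$ is larger than the number of $\circ$'s in $A$, then $S_i(A)=A$. The (multivariate) add-drop model is the Markov chain on $\mathrm{St}_h$ whose transition probability from $A=a_1\cdots a_h$ to $B$ is $$P_{A,B}=\begin{cases}\dfrac{z_i}{z_0+\cdots+z_k}&\text{if }B=S_i(a_2\cdots a_h\circ)\text{ for some }i\in\{0,\dots,k\},\\ 0&\text{otherwise,}\end{cases}$$ with $k$ the number of occurrences of $\circ$ in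 $a_2\cdots a_h\circ$. (For $h=0$ the only state is the empty word and the chain stays there.) *)

theory Defs
  imports Complex_Main
begin

datatype letter = Bullet | Circ

definition circs :: "letter list \<Rightarrow> nat" where
  "circs A = count_list A Circ"

definition St :: "nat \<Rightarrow> letter list set" where
  "St h = {A. length A = h}"

definition St_k :: "nat \<Rightarrow> nat \<Rightarrow> letter list set" where
  "St_k h k = {A \<in> St h. circs A = k}"

(* A Circ at the head of x # A is the (circs (x # A))-th Circ from the right, so at most one
   letter is changed: the i-th Circ from the right, if there is one. *)
primrec S_op :: "nat \<Rightarrow> letter list \<Rightarrow> letter list" where
  "S_op i [] = []"
| "S_op i (x # A) = (if x = Circ \<and> circs (x # A) = i then Bullet else x) # S_op i A"

(* The words S_op i W for i <= circs W are pairwise distinct (S_op_inject below), so THE picks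
   the only possible index. The empty word (h = 0) is absorbing. *)
definition add_drop_P :: "(nat \<Rightarrow> real) \<Rightarrow> letter list \<Rightarrow> letter list \<Rightarrow> real" where
  "add_drop_P z A B =
     (if A = [] then (if B = [] then 1 else 0)
      else let W = tl A @ [Circ]; k = circs W in
        (if \<exists>i\<in>{0..k}. B = S_op i W
         then z (THE i. i \<in> {0..k} \<and> B = S_op i W) / (\<Sum>j=0..k. z j)
         else 0))"

definition stationary_distribution ::
    "'s set \<Rightarrow> ('s \<Rightarrow> 's \<Rightarrow> real) \<Rightarrow> ('s \<Rightarrow> real) \<Rightarrow> bool" where
  "stationary_distribution S P \<pi> \<longleftrightarrow>
     (\<forall>x\<in>S. 0 \<le> \<pi> x) \<and> (\<Sum>x\<in>S. \<pi> x) = 1 \<and>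
     (\<forall>y\<in>S. (\<Sum>x\<in>S. \<pi> x * P x y) = \<pi> y)"

(* Complete homogeneous symmetric polynomial of degree l in the m variables x 1, ..., x m:
   the sum over weakly increasing index sequences of length l, i.e. over all monomials. *)
definition complete_hom :: "nat \<Rightarrow> nat \<Rightarrow> (nat \<Rightarrow> 'a::comm_semiring_1) \<Rightarrow> 'a" where
  "complete_hom l m x =
     (\<Sum>is\<in>{is. length is = l \<and> sorted is \<and> set is \<subseteq> {1..m}}. \<Prod>i\<leftarrow>is. x i)"

(* Letters are numbered from 1 in the formulas: b_j is B ! (j - 1). *)
definition psi :: "nat \<Rightarrow> letter list \<Rightarrow> nat" where
  "psi i B = card {j. i < j \<and> j \<le> length B \<and> B ! (j - 1) = Circ}"

definition add_drop_Z :: "(nat \<Rightarrow> real) \<Rightarrow> nat \<Rightarrow> real" where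
  "add_drop_Z z h =
     (\<Sum>k=0..h. z 0 ^ k * complete_hom (h - k) (k + 1) (\<lambda>j. \<Sum>r=1..j. z r))"

lemma finite_St: "finite (St h)"
proof -
  have "finite {A. set A \<subseteq> (UNIV :: letter set) \<and> length A = h}"
  proof (rule finite_lists_length_eq)
    have "(UNIV :: letter set) = {Bullet, Circ}"
      using letter.exhaust by blast
    then show "finite (UNIV :: letter set)" by (metis finite.emptyI finite_insert)
  qed
  then show ?thesis by (simp add: St_def)
qed

lemma length_S_op: "length (S_op i A) = length A"
  by (induction A) auto

lemma S_op_trivial: "i = 0 \<or> circs A < i \<Longrightarrow> S_op i A = A"
  by (induction A) (auto simp: circs_def split: if_splits)

lemma S_op_inject:
  assumes "i \<le> circs W" "j \<le> circs W" "S_op i W = S_op j W"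
  shows "i = j"
  using assms
proof (induction W)
  case Nil
  then show ?case by (simp add: circs_def)
next
  case (Cons x W)
  then show ?case
    by (cases x) (auto simp: circs_def le_Suc_eq split: if_splits)
qed

lemma add_drop_P_S_op:
  assumes "A \<noteq> []" "i \<le> circs (tl A @ [Circ])"
  shows "add_drop_P z A (S_op i (tl A @ [Circ])) = z i / (\<Sum>j=0..circs (tl A @ [Circ]). z j)"
proof -
  let ?W = "tl A @ [Circ]"
  have "(THE j. j \<in> {0..circs ?W} \<and> S_op i ?W = S_op j ?W) = i"
    using assms(2) S_op_inject by (intro the_equality) auto
  moreover have "\<exists>j\<in>{0..circs ?W}. S_op i ?W = S_op j ?W"
    using assms(2) by auto
  ultimately show ?thesis
    using assms(1) unfolding add_drop_P_def Let_def by simp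
qed

lemma add_drop_P_row_sum:
  assumes "\<And>i. i \<le> h \<Longrightarrow> 0 \<le> z i" "0 < z 0" "A \<in> St h"
  shows "(\<Sum>B\<in>St h. add_drop_P z A B) = 1"
proof (cases "A = []")
  case True
  then have "St h = {[]}" using assms(3) by (auto simp: St_def)
  then show ?thesis using True by (simp add: add_drop_P_def)
next
  case False
  let ?W = "tl A @ [Circ]"
  let ?k = "circs ?W"
  let ?I = "(\<lambda>i. S_op i ?W) ` {0..?k}"
  have len: "length ?W = h" using False assms(3) by (cases A) (auto simp: St_def)
  have sub: "?I \<subseteq> St h" using len by (auto simp: St_def length_S_op)
  have "?k \<le> h" using count_le_length[of ?W Circ] len by (simp add: circs_def)
  then have "0 < (\<Sum>j=0..?k. z j)"
    using assms(1,2) by (intro sum_pos2[of _ 0]) auto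
  have inj: "inj_on (\<lambda>i. S_op i ?W) {0..?k}"
    by (rule inj_onI) (auto intro: S_op_inject[of _ ?W])
  have "(\<Sum>B\<in>St h. add_drop_P z A B) = (\<Sum>B\<in>?I. add_drop_P z A B)"
    using False by (intro sum.mono_neutral_right finite_St sub)
      (auto simp: add_drop_P_def Let_def)
  also have "\<dots> = (\<Sum>i=0..?k. z i / (\<Sum>j=0..?k. z j))"
    using False by (simp add: sum.reindex[OF inj] add_drop_P_S_op)
  also have "\<dots> = 1"
    using \<open>0 < (\<Sum>j=0..?k. z j)\<close> by (simp add: sum_divide_distrib[symmetric])
  finally show ?thesis .
qed

end

theory Submission
  imports Defs
begin

text \<open>
  Reading words from the left, the unnormalised weight satisfies \<open>w (\<circ>B) = a w B\<close> and
  \<open>w (\<bullet>B) = (z\<^sub>1 + \<dots> + z\<^bsub>c+1\<^esub>) w B\<close>, where \<open>c\<close> is the number of \<open>\<circ>\<close> in \<open>B\<close>. Summing the weight over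
  the letter dropped by a transition therefore produces exactly the denominator of the transition
  probability, and the balance equation becomes polynomial; it follows by induction on the length.
  The same recursion, sorted by the number of \<open>\<circ>\<close>, is the one of the complete homogeneous polynomials,
  which gives the normalisation. For uniqueness, the positive and the negative part of the difference
  of two stationary distributions are again stationary; if nonzero, each would charge the state
  \<open>\<circ>\<dots>\<circ>\<close>, which is reached from everywhere because \<open>a > 0\<close>.
\<close>

section \<open>Uniqueness of stationary distributions\<close>

text \<open>In the balance equation at the end of an edge, the summand of its start is positive and
  no summand is negative.\<close>

lemma invariant_pos_reachable:
  fixes P :: "'s \<Rightarrow> 's \<Rightarrow> real"
  assumes "finite S" "\<And>x y. x \<in> S \<Longrightarrow> y \<in> S \<Longrightarrow> 0 \<le> P x y"
    and "\<And>x. x \<in> S \<Longrightarrow> 0 \<le> g x"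
    and "\<And>y. y \<in> S \<Longrightarrow> (\<Sum>x\<in>S. g x * P x y) = g y"
    and "(x, t) \<in> {(x, y). x \<in> S \<and> y \<in> S \<and> 0 < P x y}\<^sup>*" "0 < g x"
  shows "0 < g t"
  using assms(5,6)
proof (induction rule: rtrancl_induct)
  case (step y u)
  then have "0 < (\<Sum>x\<in>S. g x * P x u)"
    using assms(1-3) by (intro sum_pos2[of S y]) auto
  then show ?case using step assms(4) by auto
qed auto

text \<open>Passing to positive parts makes the excess \<open>?e\<close> nonnegative at every state;
  row sums equal to 1 make its total zero, so it vanishes everywhere.\<close>

lemma invariant_pos_part:
  fixes P :: "'s \<Rightarrow> 's \<Rightarrow> real"
  assumes "finite S" "\<And>x y. x \<in> S \<Longrightarrow> y \<in> S \<Longrightarrow> 0 \<le> P x y"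
    and row: "\<And>x. x \<in> S \<Longrightarrow> (\<Sum>y\<in>S. P x y) = 1"
    and inv: "\<And>y. y \<in> S \<Longrightarrow> (\<Sum>x\<in>S. d x * P x y) = d y"
    and "y \<in> S"
  shows "(\<Sum>x\<in>S. max 0 (d x) * P x y) = max 0 (d y)"
proof -
  let ?e = "\<lambda>y. (\<Sum>x\<in>S. max 0 (d x) * P x y) - max 0 (d y)"
  have nonneg: "0 \<le> ?e y" if "y \<in> S" for y
  proof -
    have "d y \<le> (\<Sum>x\<in>S. max 0 (d x) * P x y)"
      unfolding inv[OF that, symmetric]
      using assms(2) that by (intro sum_mono mult_right_mono) auto
    moreover have "0 \<le> (\<Sum>x\<in>S. max 0 (d x) * P x y)"
      using assms(2) that by (intro sum_nonneg) auto
    ultimately show ?thesis by simp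
  qed
  have "(\<Sum>y\<in>S. \<Sum>x\<in>S. max 0 (d x) * P x y) = (\<Sum>x\<in>S. \<Sum>y\<in>S. max 0 (d x) * P x y)"
    by (rule sum.swap)
  also have "\<dots> = (\<Sum>x\<in>S. max 0 (d x))"
    by (intro sum.cong) (simp_all add: sum_distrib_left[symmetric] row)
  finally have "(\<Sum>y\<in>S. ?e y) = 0" by (simp add: sum_subtractf)
  then have "?e y = 0"
    using sum_nonneg_eq_0_iff[OF \<open>finite S\<close>, of ?e] nonneg \<open>y \<in> S\<close> by blast
  then show ?thesis by simp
qed

lemma stationary_distribution_unique:
  fixes P :: "'s \<Rightarrow> 's \<Rightarrow> real"
  assumes fin: "finite S" and P: "\<And>x y. x \<in> S \<Longrightarrow> y \<in> S \<Longrightarrow> 0 \<le> P x y"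
    and row: "\<And>x. x \<in> S \<Longrightarrow> (\<Sum>y\<in>S. P x y) = 1"
    and reach: "\<And>x. x \<in> S \<Longrightarrow> (x, t) \<in> {(x, y). x \<in> S \<and> y \<in> S \<and> 0 < P x y}\<^sup>*"
    and st: "stationary_distribution S P p" "stationary_distribution S P q" and "x \<in> S"
  shows "p x = q x"
proof -
  have pos: "0 < d t"
    if "\<And>y. y \<in> S \<Longrightarrow> (\<Sum>x\<in>S. d x * P x y) = d y" "x \<in> S" "0 < d x" for d x
  proof -
    have "0 < max 0 (d t)"
      by (rule invariant_pos_reachable[OF fin P _ _ reach[OF \<open>x \<in> S\<close>]])
        (use that in \<open>auto intro: invariant_pos_part[OF fin P row]\<close>)
    then show ?thesis by simp
  qed
  have no_gap: "q' x \<le> p' x" if "stationary_distribution S P p'" "stationary_distribution S P q'"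
    "x \<in> S" for p' q' x
  \<comment> \<open>If \<open>q'\<close> exceeds \<open>p'\<close> anywhere, it does so at
    \<open>t\<close>. Then \<open>p'\<close> exceeds \<open>q'\<close> nowhere, as this would
    reverse the inequality at \<open>t\<close>, so the totals cannot both be 1.\<close>
  proof (rule ccontr)
    assume "\<not> q' x \<le> p' x"
    have inv: "(\<Sum>x\<in>S. (q' x - p' x) * P x y) = q' y - p' y"
      "(\<Sum>x\<in>S. (p' x - q' x) * P x y) = p' y - q' y" if "y \<in> S" for y
      using that \<open>stationary_distribution S P p'\<close> \<open>stationary_distribution S P q'\<close>
      by (simp_all add: stationary_distribution_def left_diff_distrib sum_subtractf)
    have "0 < q' t - p' t"
      using pos[of "\<lambda>x. q' x - p' x" x] inv(1) \<open>\<not> q' x \<le> p' x\<close> \<open>x \<in> S\<close> by auto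
    then have "\<not> 0 < p' y - q' y" if "y \<in> S" for y
      using pos[of "\<lambda>x. p' x - q' x" y] inv(2) that by auto
    then have "(\<Sum>x\<in>S. p' x) < (\<Sum>x\<in>S. q' x)"
      using fin \<open>x \<in> S\<close> \<open>\<not> q' x \<le> p' x\<close> by (intro sum_strict_mono_ex1) (auto simp: not_less not_le)
    then show False using that(1,2) by (simp add: stationary_distribution_def)
  qed
  show ?thesis using no_gap[of p q x] no_gap[of q p x] st \<open>x \<in> S\<close> by (simp add: antisym)
qed

section \<open>Complete homogeneous symmetric polynomials\<close>

lemma complete_hom_0 [simp]: "complete_hom 0 m x = 1"
proof -
  have "{is::nat list. length is = 0 \<and> sorted is \<and> set is \<subseteq> {1..m}} = {[]}" by auto
  then show ?thesis by (simp add: complete_hom_def)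
qed

lemma complete_hom_no_vars [simp]: "complete_hom (Suc l) 0 x = 0"
proof -
  have "{is::nat list. length is = Suc l \<and> sorted is \<and> set is \<subseteq> {1..0}} = {}" by auto
  then show ?thesis unfolding complete_hom_def by (metis sum.empty)
qed

text \<open>A weakly increasing index sequence either avoids \<open>Suc m\<close> or ends with it;
  in the second case the last entry is split off.\<close>

lemma complete_hom_Suc_Suc:
  "complete_hom (Suc l) (Suc m) x = complete_hom (Suc l) m x + x (Suc m) * complete_hom l (Suc m) x"
proof -
  define L where "L l m = {is::nat list. length is = l \<and> sorted is \<and> set is \<subseteq> {1..m}}" for l m
  let ?snoc = "\<lambda>is. is @ [Suc m]"
  have "finite (L l m)" for l m
    by (rule finite_subset[OF _ finite_lists_length_eq[of "{1..m}" l]]) (auto simp: L_def)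
  moreover have "L (Suc l) (Suc m) = L (Suc l) m \<union> ?snoc ` L l (Suc m)"
  proof (intro equalityI subsetI)
    fix js assume js: "js \<in> L (Suc l) (Suc m)"
    then obtain us j where [simp]: "js = us @ [j]"
      by (cases js rule: rev_cases) (auto simp: L_def)
    show "js \<in> L (Suc l) m \<union> ?snoc ` L l (Suc m)"
    proof (cases "j = Suc m")
      case False
      then have "j \<le> m" using js by (auto simp: L_def)
      then show ?thesis using js by (fastforce simp: L_def sorted_append)
    qed (use js in \<open>auto simp: L_def sorted_append\<close>)
  qed (fastforce simp: L_def sorted_append)
  moreover have "L (Suc l) m \<inter> ?snoc ` L l (Suc m) = {}" by (auto simp: L_def)
  moreover have "inj_on ?snoc (L l (Suc m))" by (rule inj_onI) simp
  ultimately show ?thesis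
    unfolding complete_hom_def L_def[symmetric]
    by (simp add: sum.union_disjoint sum.reindex sum_distrib_left mult.commute)
qed

section \<open>The weight of a word\<close>

text \<open>Prepending a letter does not change how many \<open>Circ\<close> stand to the right of
  the other letters, so the product formula becomes a recursion on the first letter.\<close>

primrec weight :: "(nat \<Rightarrow> real) \<Rightarrow> letter list \<Rightarrow> real" where
  "weight z [] = 1"
| "weight z (x # B) =
     (case x of Circ \<Rightarrow> z 0 | Bullet \<Rightarrow> \<Sum>r=1..circs B + 1. z r) * weight z B"

lemma circs_simps [simp]:
  "circs [] = 0" "circs (Circ # A) = Suc (circs A)" "circs (Bullet # A) = circs A"
  "circs (A @ B) = circs A + circs B"
  by (simp_all add: circs_def)

lemma circs_le_length: "circs A \<le> length A"
  by (simp add: circs_def count_le_length)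

lemma psi_eq_circs_drop: "psi i B = circs (drop i B)"
proof -
  have "circs (drop i B) = length (filter ((=) Circ) (drop i B))"
    by (simp add: circs_def count_list_eq_length_filter)
  also have "\<dots> = card {j. j < length B - i \<and> B ! (i + j) = Circ}"
    unfolding length_filter_conv_card by (rule arg_cong[of _ _ card]) auto
  also have "\<dots> = card {j. i < j \<and> j \<le> length B \<and> B ! (j - 1) = Circ}"
    \<comment> \<open>The 0-based offset \<open>j\<close> in \<open>drop i B\<close> is the 1-based
      position \<open>Suc (i + j)\<close> in \<open>B\<close>.\<close>
    by (rule bij_betw_same_card[of "\<lambda>j. Suc (i + j)"],
        rule bij_betw_byWitness[where f' = "\<lambda>j. j - Suc i"]) auto
  finally show ?thesis by (simp add: psi_def)
qed

lemma weight_eq_prod: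
  "weight z B = z 0 ^ circs B *
     (\<Prod>i\<in>{i\<in>{1..length B}. B ! (i - 1) = Bullet}. \<Sum>r=1..psi i B + 1. z r)"
proof (induction B)
  case (Cons x B)
  define I where "I = {i\<in>{1..length B}. B ! (i - 1) = Bullet}"
  have J: "{i\<in>{1..length (x # B)}. (x # B) ! (i - 1) = Bullet} =
      (if x = Bullet then {1} else {}) \<union> Suc ` I" (is "?J = ?K")
  proof (intro equalityI subsetI)
    fix i assume "i \<in> ?J"
    then show "i \<in> ?K"
      by (cases i; cases "i - 1") (auto simp: image_iff I_def)
  qed (auto simp: I_def split: if_splits)
  have "finite I" "1 \<notin> Suc ` I" by (auto simp: I_def)
  then show ?case
    unfolding J using Cons[folded I_def]
    by (cases x) (simp_all add: prod.reindex psi_eq_circs_drop)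
qed simp

lemma weight_nonneg:
  assumes "\<And>i. i \<le> length B \<Longrightarrow> 0 \<le> z i"
  shows "0 \<le> weight z B"
  using assms
proof (induction B)
  case (Cons x B)
  have "0 \<le> (\<Sum>r=1..circs B + 1. z r)"
    using Cons.prems circs_le_length[of B] by (intro sum_nonneg) auto
  then show ?case using Cons by (auto split: letter.split)
qed simp

lemma weight_replicate_Circ: "weight z (replicate n Circ) = z 0 ^ n"
  by (induction n) auto

section \<open>The normalisation\<close>

lemma St_0: "St 0 = {[]}"
  by (auto simp: St_def)

lemma sum_St_Suc:
  "(\<Sum>A\<in>St (Suc n). f A) = (\<Sum>A\<in>St n. f (Circ # A)) + (\<Sum>A\<in>St n. f (Bullet # A))"
proof -
  have "St (Suc n) = (#) Circ ` St n \<union> (#) Bullet ` St n"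
    by (auto simp: St_def length_Suc_conv image_iff) (metis letter.exhaust)
  moreover have "(#) Circ ` St n \<inter> (#) Bullet ` St n = {}" by auto
  ultimately show ?thesis
    by (simp add: sum.union_disjoint sum.reindex finite_St)
qed

text \<open>Splitting by the first letter matches \<open>complete_hom_Suc_Suc\<close>:
  \<open>Circ\<close> gives the term without the last variable, \<open>Bullet\<close> the term with
  that variable as a factor.\<close>

lemma sum_weight_St_k:
  "k \<le> h \<Longrightarrow> (\<Sum>B\<in>St h. if circs B = k then weight z B else 0) =
     z 0 ^ k * complete_hom (h - k) (k + 1) (\<lambda>j. \<Sum>r=1..j. z r)"
proof (induction h arbitrary: k)
  case 0
  then show ?case by (simp add: St_0)
next
  case (Suc h)
  let ?G = "\<lambda>j. \<Sum>r=1..j. z r"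
  let ?T = "\<lambda>k. \<Sum>B\<in>St h. if circs B = k then weight z B else 0"
  have bullet: "(\<Sum>B\<in>St h. if circs (Bullet # B) = k then weight z (Bullet # B) else 0) =
      ?G (k + 1) * ?T k"
    by (auto simp: sum_distrib_left intro!: sum.cong)
  have circ: "(\<Sum>B\<in>St h. if circs (Circ # B) = Suc j then weight z (Circ # B) else 0) =
      z 0 * ?T j" for j
    by (auto simp: sum_distrib_left intro!: sum.cong)
  show ?case
  proof (cases k)
    case 0
    then show ?thesis
      using Suc.IH[of 0] bullet by (simp add: sum_St_Suc complete_hom_Suc_Suc)
  next
    case (Suc j)
    show ?thesis
    proof (cases "j = h")
      \<comment> \<open>Here \<open>k = Suc h\<close> exceeds the length of the tail, so words
        starting with \<open>Bullet\<close> contribute nothing and the polynomial has degree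
        0.\<close>
      case True
      have "circs B \<noteq> Suc h" if "B \<in> St h" for B
        using that circs_le_length[of B] by (auto simp: St_def)
      then have "?T k = 0" using Suc True by (intro sum.neutral) auto
      then show ?thesis
        using Suc True Suc.IH[of h] bullet circ[of j] by (simp only: sum_St_Suc) simp
    next
      case False
      then have "h - j = Suc (h - k)" "k \<le> h" using Suc Suc.prems by auto
      then show ?thesis
        using Suc Suc.IH[of j] Suc.IH[of k] bullet circ[of j]
        by (simp only: sum_St_Suc) (simp add: complete_hom_Suc_Suc[of _ "Suc j"] algebra_simps)
    qed
  qed
qed

lemma sum_weight_eq_add_drop_Z: "(\<Sum>B\<in>St h. weight z B) = add_drop_Z z h"
proof -
  have "(\<Sum>B\<in>St h. weight z B) = (\<Sum>B\<in>St h. \<Sum>k=0..h. if circs B = k then weight z B else 0)"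
    using circs_le_length by (intro sum.cong) (auto simp: St_def)
  also have "\<dots> = (\<Sum>k=0..h. \<Sum>B\<in>St h. if circs B = k then weight z B else 0)"
    by (rule sum.swap)
  also have "\<dots> = add_drop_Z z h"
    unfolding add_drop_Z_def by (intro sum.cong sum_weight_St_k) auto
  finally show ?thesis .
qed

lemma add_drop_Z_pos:
  assumes "\<And>i. i \<le> h \<Longrightarrow> 0 \<le> z i" "0 < z 0"
  shows "0 < add_drop_Z z h"
  unfolding sum_weight_eq_add_drop_Z[symmetric]
  using assms
  by (intro sum_pos2[of _ "replicate h Circ"])
    (auto simp: finite_St, auto simp: St_def weight_replicate_Circ intro: weight_nonneg)

section \<open>Balance\<close>

text \<open>In the balance argument this gives \<open>circs B' = circs A\<close> whenever a positive
  index turns \<open>A @ [Circ]\<close> into \<open>B'\<close>.\<close>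

lemma circs_S_op: "1 \<le> i \<Longrightarrow> i \<le> circs W \<Longrightarrow> Suc (circs (S_op i W)) = circs W"
proof (induction W)
  case (Cons x W)
  then show ?case
    by (cases x) (auto simp: S_op_trivial le_Suc_eq)
qed simp

lemma S_op_0 [simp]: "S_op 0 W = W"
  by (simp add: S_op_trivial)

text \<open>This is the balance equation after cancelling denominators: \<open>A\<close> is the
  state without its dropped letter. The induction compares the first letters of \<open>A\<close> and
  \<open>B\<close>.\<close>

lemma weight_balance:
  assumes "length B = Suc n"
  shows "(\<Sum>A\<in>St n. \<Sum>i\<le>Suc (circs A). if S_op i (A @ [Circ]) = B then z i * weight z A else 0) =
    weight z B"
  using assms
proof (induction n arbitrary: B)
  case 0
  then obtain x where "B = [x]" by (cases B) auto
  then show ?case by (cases x) (auto simp: St_0)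
next
  case (Suc n)
  then obtain x B' where B: "B = x # B'" and len: "length B' = Suc n"
    by (cases B) auto
  let ?G = "\<lambda>j. \<Sum>r=1..j. z r"
  let ?T = "\<lambda>A. \<Sum>i\<le>Suc (circs A). if S_op i (A @ [Circ]) = B' then z i * weight z A else 0"
  let ?U = "\<lambda>A B. \<Sum>i\<le>Suc (circs A). if S_op i (A @ [Circ]) = B then z i * weight z A else 0"
  have IH: "(\<Sum>A\<in>St n. ?T A) = weight z B'" using Suc.IH len by blast
  show ?case
  proof (cases x)
    case Circ
    \<comment> \<open>A leading \<open>Circ\<close> of \<open>B\<close> comes only from a leading
      \<open>Circ\<close>, and the top index \<open>circs A + 2\<close> is excluded because it would
      change that letter.\<close>
    have "?U (Circ # A) B = z 0 * ?T A" for A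
    proof -
      have "?U (Circ # A) B = (\<Sum>i\<le>Suc (circs A).
          if S_op i ((Circ # A) @ [Circ]) = B then z i * weight z (Circ # A) else 0)"
        by (simp add: B Circ)
      also have "\<dots> = z 0 * ?T A"
        unfolding sum_distrib_left by (intro sum.cong) (auto simp: B Circ)
      finally show ?thesis .
    qed
    moreover have "?U (Bullet # A) B = 0" for A
      by (simp add: B Circ)
    ultimately show ?thesis
      unfolding sum_St_Suc using IH by (simp only: sum_distrib_left[symmetric]) (simp add: B Circ)
  next
    case Bullet
    \<comment> \<open>From \<open>Circ # A\<close> a leading \<open>Bullet\<close> arises only with
      index \<open>circs A + 2\<close>, the rank of the head from the right; this index leaves
      \<open>A @ [Circ]\<close> unchanged.\<close>
    let ?c = "\<lambda>A. if A @ [Circ] = B' then z (circs A + 2) * (z 0 * weight z A) else 0"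
    have circ: "?U (Circ # A) B = ?c A" for A
    proof -
      have "?U (Circ # A) B =
          (\<Sum>i\<le>Suc (Suc (circs A)). if i = Suc (Suc (circs A)) then ?c A else 0)"
        by (intro sum.cong) (auto simp: B Bullet S_op_trivial)
      then show ?thesis by simp
    qed
    \<comment> \<open>An index \<open>i > 0\<close> that produces \<open>B'\<close> gives the factor of \<open>weight z (Bullet # B')\<close>; the index
      \<open>0\<close> falls short by one summand, which is what the words \<open>Circ # A\<close> contribute.\<close>
    have bullet: "?U (Bullet # A) B + ?c A = ?G (circs B' + 1) * ?T A" for A
    proof -
      define R where
        "R = (\<Sum>i\<le>circs A. if S_op (Suc i) (A @ [Circ]) = B' then z (Suc i) * weight z A else 0)"
      have "(if S_op (Suc i) (A @ [Circ]) = B' then z (Suc i) * weight z (Bullet # A) else 0) =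
          ?G (circs B' + 1) *
            (if S_op (Suc i) (A @ [Circ]) = B' then z (Suc i) * weight z A else 0)"
        if "i \<le> circs A" for i
        using that circs_S_op[of "Suc i" "A @ [Circ]"] by auto
      then have "(\<Sum>i\<le>circs A. if S_op (Suc i) (A @ [Circ]) = B'
              then z (Suc i) * weight z (Bullet # A) else 0) = ?G (circs B' + 1) * R"
        unfolding R_def sum_distrib_left by (intro sum.cong) auto
      then have "?U (Bullet # A) B =
          (if A @ [Circ] = B' then z 0 * weight z (Bullet # A) else 0) + ?G (circs B' + 1) * R"
        by (simp add: B Bullet sum.atMost_Suc_shift del: sum.atMost_Suc weight.simps)
      moreover have "?T A = (if A @ [Circ] = B' then z 0 * weight z A else 0) + R"
        by (simp add: R_def sum.atMost_Suc_shift del: sum.atMost_Suc)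
      ultimately show ?thesis
        by (simp only:) (auto simp: algebra_simps)
    qed
    have "(\<Sum>A\<in>St (Suc n). ?U A B) = (\<Sum>A\<in>St n. ?U (Bullet # A) B + ?c A)"
      by (simp only: sum_St_Suc circ sum.distrib add.commute)
    also have "\<dots> = ?G (circs B' + 1) * weight z B'"
      by (simp only: bullet sum_distrib_left[symmetric] IH)
    finally show ?thesis by (simp add: B Bullet)
  qed
qed

text \<open>Injectivity of \<open>S_op\<close> lets a sum with at most one nonzero term replace
  \<open>THE\<close>. The right side is free of \<open>x\<close>, so both states with tail
  \<open>A\<close> have the same transition probabilities.\<close>

lemma add_drop_P_Cons:
  "add_drop_P z (x # A) B =
     (\<Sum>i\<le>Suc (circs A). if S_op i (A @ [Circ]) = B then z i else 0) / (\<Sum>j\<le>Suc (circs A). z j)"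
proof (cases "\<exists>i\<le>Suc (circs A). B = S_op i (A @ [Circ])")
  case True
  then obtain i where i: "i \<le> Suc (circs A)" "B = S_op i (A @ [Circ])" by blast
  have "(\<Sum>j\<le>Suc (circs A). if S_op j (A @ [Circ]) = B then z j else 0) =
      (\<Sum>j\<le>Suc (circs A). if j = i then z j else 0)"
    using i S_op_inject[of _ "A @ [Circ]" i] by (intro sum.cong) auto
  also have "\<dots> = z i" using i(1) by (simp add: sum.delta del: sum.atMost_Suc)
  finally show ?thesis
    using i add_drop_P_S_op[of "x # A" i z] by (simp add: atMost_atLeast0)
next
  case False
  then have "(\<Sum>i\<le>Suc (circs A). if S_op i (A @ [Circ]) = B then z i else 0) = 0"
    by (intro sum.neutral) auto
  then show ?thesis using False by (auto simp: add_drop_P_def Let_def)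
qed

lemma add_drop_P_nonneg:
  assumes "\<And>i. i \<le> h \<Longrightarrow> 0 \<le> z i" "A \<in> St h"
  shows "0 \<le> add_drop_P z A B"
proof (cases A)
  case (Cons x A')
  then have "Suc (circs A') \<le> h" using assms(2) circs_le_length[of A'] by (auto simp: St_def)
  then show ?thesis
    unfolding Cons add_drop_P_Cons
    using assms(1) by (intro divide_nonneg_nonneg sum_nonneg) auto
qed (simp add: add_drop_P_def)

lemma weight_invariant:
  assumes "\<And>i. i \<le> h \<Longrightarrow> 0 \<le> z i" "0 < z 0" "B \<in> St h"
  shows "(\<Sum>A\<in>St h. weight z A * add_drop_P z A B) = weight z B"
proof (cases h)
  case 0
  then show ?thesis using assms(3) by (auto simp: St_0 add_drop_P_def)
next
  case (Suc n)
  have "weight z (Circ # A) * add_drop_P z (Circ # A) B +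
      weight z (Bullet # A) * add_drop_P z (Bullet # A) B =
      (\<Sum>i\<le>Suc (circs A). if S_op i (A @ [Circ]) = B then z i * weight z A else 0)"
    if "A \<in> St n" for A
  proof -
    let ?D = "\<Sum>j\<le>Suc (circs A). z j"
    let ?N = "\<Sum>i\<le>Suc (circs A). if S_op i (A @ [Circ]) = B then z i else 0"
    have "Suc (circs A) \<le> h"
      using that Suc circs_le_length[of A] by (auto simp: St_def)
    then have "0 < ?D" using assms(1,2) by (intro sum_pos2[of _ 0]) auto
    \<comment> \<open>The two summands are the factors that \<open>weight\<close> attaches to a
      leading \<open>Circ\<close> and a leading \<open>Bullet\<close>.\<close>
    have "?D = z 0 + (\<Sum>r=1..circs A + 1. z r)"
      by (simp add: atMost_atLeast0 sum.atLeast_Suc_atMost del: sum.cl_ivl_Suc)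
    then have "weight z (Circ # A) + weight z (Bullet # A) = ?D * weight z A"
      by (simp add: algebra_simps)
    then have "weight z (Circ # A) * (?N / ?D) + weight z (Bullet # A) * (?N / ?D) =
        ?D * weight z A * (?N / ?D)"
      by (simp only: distrib_right[symmetric])
    also have "\<dots> = ?N * weight z A" using \<open>0 < ?D\<close> by (simp del: sum.atMost_Suc)
    also have "\<dots> = (\<Sum>i\<le>Suc (circs A). if S_op i (A @ [Circ]) = B then z i * weight z A else 0)"
      unfolding sum_distrib_right by (intro sum.cong) auto
    finally show ?thesis by (simp only: add_drop_P_Cons)
  qed
  then have "(\<Sum>A\<in>St h. weight z A * add_drop_P z A B) =
      (\<Sum>A\<in>St n. \<Sum>i\<le>Suc (circs A). if S_op i (A @ [Circ]) = B then z i * weight z A else 0)"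
    unfolding Suc sum_St_Suc sum.distrib[symmetric] by (intro sum.cong) auto
  also have "\<dots> = weight z B"
    using assms(3) Suc by (intro weight_balance) (simp add: St_def)
  finally show ?thesis .
qed

section \<open>The stationary distribution\<close>

lemma add_drop_reach_Circs:
  assumes "\<And>i. i \<le> h \<Longrightarrow> 0 \<le> z i" "0 < z 0" "A \<in> St h"
  shows "(A, replicate h Circ) \<in> {(A, B). A \<in> St h \<and> B \<in> St h \<and> 0 < add_drop_P z A B}\<^sup>*"
    (is "_ \<in> ?R\<^sup>*")
proof -
  \<comment> \<open>\<open>A'\<close> is the part of the initial state not yet dropped. Each step
    uses index 0, which has positive probability and only appends \<open>Circ\<close>.\<close>
  have "(A' @ replicate (h - length A') Circ, replicate h Circ) \<in> ?R\<^sup>*" if "length A' \<le> h" for A'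
    using that
  proof (induction A')
    case (Cons x A')
    let ?C = "A' @ replicate (h - Suc (length A')) Circ"
    have next_word: "?C @ [Circ] = A' @ replicate (h - length A') Circ"
      using Cons.prems by (simp add: replicate_append_same Suc_diff_Suc flip: replicate_Suc)
    have "Suc (circs ?C) \<le> h" using circs_le_length[of ?C] Cons.prems by simp
    then have "0 < (\<Sum>j=0..circs (?C @ [Circ]). z j)"
      using assms(1,2) by (intro sum_pos2[of _ 0]) auto
    then have "0 < add_drop_P z (x # ?C) (?C @ [Circ])"
      using add_drop_P_S_op[of "x # ?C" 0 z] assms(2) by simp
    then have "(x # ?C, ?C @ [Circ]) \<in> ?R" using Cons.prems by (simp add: St_def)
    then show ?case
      using Cons unfolding next_word by (auto intro: converse_rtrancl_into_rtrancl)
  qed simp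
  from this[of A] show ?thesis using assms(3) by (simp add: St_def)
qed

theorem theorem4p4:
  fixes h :: nat and z :: "nat \<Rightarrow> real" and a :: real
  assumes "a = z 0" and "\<And>i. i \<le> h \<Longrightarrow> 0 \<le> z i" and "0 < a"
  shows "\<exists>\<Pi>. stationary_distribution (St h) (add_drop_P z) \<Pi> \<and>
           (\<forall>\<pi>. stationary_distribution (St h) (add_drop_P z) \<pi> \<longrightarrow> (\<forall>B\<in>St h. \<pi> B = \<Pi> B)) \<and>
           (\<forall>k\<in>{0..h}. \<forall>B\<in>St_k h k.
              \<Pi> B = a ^ k / add_drop_Z z h *
                (\<Prod>i\<in>{i\<in>{1..h}. B ! (i - 1) = Bullet}. \<Sum>r=1..psi i B + 1. z r))"
proof -
  define \<Pi> where "\<Pi> B = weight z B / add_drop_Z z h" for B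
  have z0: "0 < z 0" using assms(1,3) by simp
  have Z_pos: "0 < add_drop_Z z h" using assms(2) z0 by (rule add_drop_Z_pos)
  have st: "stationary_distribution (St h) (add_drop_P z) \<Pi>"
    unfolding stationary_distribution_def
  proof (intro conjI ballI)
    fix B assume B: "B \<in> St h"
    show "0 \<le> \<Pi> B"
      unfolding \<Pi>_def using B Z_pos assms(2)
      by (intro divide_nonneg_pos weight_nonneg) (auto simp: St_def)
    show "(\<Sum>A\<in>St h. \<Pi> A * add_drop_P z A B) = \<Pi> B"
      using weight_invariant[of h z, OF assms(2) z0 B]
      by (simp add: \<Pi>_def sum_divide_distrib[symmetric])
  next
    show "(\<Sum>B\<in>St h. \<Pi> B) = 1"
      using Z_pos by (simp add: \<Pi>_def sum_divide_distrib[symmetric] sum_weight_eq_add_drop_Z)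
  qed
  have "\<pi> B = \<Pi> B" if "stationary_distribution (St h) (add_drop_P z) \<pi>" "B \<in> St h" for \<pi> B
    using finite_St add_drop_P_nonneg[of h z, OF assms(2)] add_drop_P_row_sum[of h z, OF assms(2) z0]
      add_drop_reach_Circs[of h z, OF assms(2) z0] that(1) st that(2)
    by (rule stationary_distribution_unique)
  moreover have "\<Pi> B = a ^ k / add_drop_Z z h *
      (\<Prod>i\<in>{i\<in>{1..h}. B ! (i - 1) = Bullet}. \<Sum>r=1..psi i B + 1. z r)" if "B \<in> St_k h k" for k B
    using that weight_eq_prod[of z B] by (simp add: \<Pi>_def St_k_def St_def assms(1))
  ultimately show ?thesis using st by blast
qed

end
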